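(* The algebras $\mathcal A^{\rm phys}_{S|R_1}$ and $\mathcal A^{\rm phys}_{S|R_2}$ of relational observables describing solely $S$ relative to the two frames are distinct, but isomorphic, subalgebras of $\mathcal A_{\rm phys}$; i.e. $\mathcal A^{\rm phys}_{S|R_1}\neq\mathcal A^{\rm phys}_{S|R_2}$. Their overlap $\mathcal A^{\rm phys}_{S|R_1}\cap\mathcal A^{\rm phys}_{S|R_2}$ is non-trivial and consists of all operators of the form $(\mathbf 1_1\otimes\mathbf 1_2\otimes f_S)\,\Pi_{\rm phys}=(\mathbf 1_1\otimes\mathbf 1_2\otimes f_S)|_{\mathcal H_{\rm phys}}$, where $f_S\in\mathcal A_S$ is translation-invariant, $[f_S,U_S^g]=0$ for all $g\in\mathcal G$. Hence, observables in the overlap commute with the reorientations of both frames.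
   Context: $\mathcal G$ is a finite abelian group, $\mathcal G\neq\{e\}$. For $i=1,2$ (two ideal quantum reference frames $R_1,R_2$), $\mathcal H_i=\ell^2(\mathcal G)\cong\mathbb C^{|\mathcal G|}$ has orthonormal basis $\{|g\rangle_i\}_{g\in\mathcal G}$ and carries the regular representation $U_i^g|g'\rangle_i=|gg'\rangle_i$. $\mathcal H_S$ is a (possibly infinite-dimensional) complex Hilbert space carrying a unitary representation $g\mapsto U_S^g$ of $\mathcal G$. $\mathcal A_S$ denotes the algebra of (bounded) linear operators on $\mathcal H_S$, and similarly for other spaces. On $\mathcal H_{\rm kin}=\mathcal H_1\otimes\mathcal H_2\otimes\mathcal H_S$ let $U_{12S}^g=U_1^g\otimes U_2^g\otimes U_S^g$, let $\Pi_{\rm phys}=\frac1{|\mathcal G|}\sum_{g\in\mathcal G}U_{12S}^g$ (an orthogonal projector), $\mathcal H_{\rm phys}=\Pi_{\rm phys}(\mathcal H_{\rm kin})$, and $\mathcal A_{\rm phys}=\mathcal L(\mathcal H_{\rm phys})$. For $i\neq j$ in $\{1,2\}$ and $g_i\in\mathcal G$, the relational observable describing $f_S\in\mathcal A_S$ relative to $R_i$ in orientation $g_i$ is $$O^{g_i}_{\mathbf 1_j\otimes f_S|R_i}=|\mathcal G|\,\Pi_{\rm phys}\bigl(|g_i\rangle\langle g_i|_i\otimes \mathbf 1_j\otimes f_S\bigr)\Pi_{\rm phys}$$ regarded as an operator on $\mathcal H_{\rm phys}$ (tensor factors placed in their appropriate slots), and $\mathcal A^{\rm phys}_{S|R_i}=\{O^{g_i}_{\mathbf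 1_j\otimes f_S|R_i}: f_S\in\mathcal A_S\}$; this set is a subalgebra of $\mathcal A_{\rm phys}$ and does not depend on $g_i$. "Non-trivial" overlap means that it is not just $\mathbb C\mathbf 1$. The reorientations of frame $R_1$ (resp. $R_2$) are the operators $U_1^g\otimes\mathbf 1_2\otimes\mathbf 1_S$ (resp. $\mathbf 1_1\otimes U_2^g\otimes\mathbf 1_S$), $g\in\mathcal G$, which preserve $\mathcal H_{\rm phys}$.
   Formalization: Distinctness of the algebras is claimed only if some U_S^g is not a multiple of the identity (otherwise the two algebras coincide), and non-triviality of the overlap only if dim H_S ≥ 2 (otherwise the overlap is just the scalars). *)

theory Defs
  imports "HOL-Analysis.Analysis" "HOL-Library.FuncSet"
begin

section \<open>Complex Hilbert spaces\<close>

text \<open>Completeness comes from the superclass \<^class>\<open>banach\<close>. The inner product is antilinear in its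
  first argument; \<open>cinner_self\<close> gives positivity and definiteness, and says that the norm is the
  one induced by the inner product.\<close>

class complex_hilbert = banach +
  fixes scaleC :: "complex \<Rightarrow> 'a \<Rightarrow> 'a"  (infixr \<open>*\<^sub>C\<close> 75)
    and cinner :: "'a \<Rightarrow> 'a \<Rightarrow> complex"
  assumes scaleC_add_right: "c *\<^sub>C (x + y) = c *\<^sub>C x + c *\<^sub>C y"
    and scaleC_add_left: "(c + d) *\<^sub>C x = c *\<^sub>C x + d *\<^sub>C x"
    and scaleC_scaleC: "c *\<^sub>C d *\<^sub>C x = (c * d) *\<^sub>C x"
    and scaleR_scaleC: "r *\<^sub>R x = complex_of_real r *\<^sub>C x"
    and cinner_add_right: "cinner x (y + z) = cinner x y + cinner x z"
    and cinner_scaleC_right: "cinner x (c *\<^sub>C y) = c * cinner x y"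
    and cinner_commute: "cinner x y = cnj (cinner y x)"
    and cinner_self: "cinner x x = complex_of_real ((norm x)\<^sup>2)"

instantiation complex :: complex_hilbert
begin
definition scaleC_complex :: "complex \<Rightarrow> complex \<Rightarrow> complex"
  where "scaleC_complex c x = c * x"
definition cinner_complex :: "complex \<Rightarrow> complex \<Rightarrow> complex"
  where "cinner_complex x y = cnj x * y"
instance
proof
  fix x :: complex
  show "cinner x x = complex_of_real ((norm x)\<^sup>2)"
    unfolding cinner_complex_def by (metis complex_norm_square mult.commute)
qed (simp_all add: scaleC_complex_def cinner_complex_def algebra_simps scaleR_conv_of_real)
end

text \<open>The library equips \<^typ>\<open>'a ^ 'n\<close> with the 2-norm, so it is the Hilbert space direct sum
  of copies of \<^typ>\<open>'a\<close>.\<close>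

instantiation vec :: (complex_hilbert, finite) complex_hilbert
begin
definition scaleC_vec :: "complex \<Rightarrow> 'a ^ 'b \<Rightarrow> 'a ^ 'b"
  where "scaleC_vec c x = (\<chi> i. c *\<^sub>C (x $ i))"
definition cinner_vec :: "'a ^ 'b \<Rightarrow> 'a ^ 'b \<Rightarrow> complex"
  where "cinner_vec x y = (\<Sum>i\<in>UNIV. cinner (x $ i) (y $ i))"
instance
proof
  fix x y :: "'a ^ 'b"
  show "cinner x y = cnj (cinner y x)"
    unfolding cinner_vec_def cnj_sum by (rule sum.cong[OF refl]) (rule cinner_commute)
  show "cinner x x = complex_of_real ((norm x)\<^sup>2)"
    by (simp add: cinner_vec_def cinner_self norm_vec_def L2_set_def sum_nonneg)
qed (simp_all add: scaleC_vec_def cinner_vec_def vec_eq_iff scaleC_add_right scaleC_add_left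
      scaleC_scaleC scaleR_scaleC cinner_add_right cinner_scaleC_right sum.distrib sum_distrib_left)
end

section \<open>Algebras of bounded operators\<close>

text \<open>The bounded complex-linear operators on a subspace \<open>H\<close>. An operator on \<open>H\<close> is represented by
  its extensional function on \<open>H\<close> (value \<^const>\<open>undefined\<close> off \<open>H\<close>), so that HOL equality is
  equality of operators on \<open>H\<close>.\<close>

definition bounded_ops :: "'h::complex_hilbert set \<Rightarrow> ('h \<Rightarrow> 'h) set"
  where "bounded_ops H = {T \<in> H \<rightarrow>\<^sub>E H.
    (\<forall>x\<in>H. \<forall>y\<in>H. T (x + y) = T x + T y) \<and>
    (\<forall>c. \<forall>x\<in>H. T (c *\<^sub>C x) = c *\<^sub>C T x) \<and>
    (\<exists>K. \<forall>x\<in>H. norm (T x) \<le> norm x * K)}"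

lemma bounded_ops_UNIV:
  "bounded_ops UNIV = {T :: 'h::complex_hilbert \<Rightarrow> 'h. bounded_linear T \<and> (\<forall>c x. T (c *\<^sub>C x) = c *\<^sub>C T x)}"
  unfolding bounded_ops_def bounded_linear_def bounded_linear_axioms_def linear_iff
  by (auto simp: scaleR_scaleC)

definition adjoint_on :: "'h::complex_hilbert set \<Rightarrow> ('h \<Rightarrow> 'h) \<Rightarrow> ('h \<Rightarrow> 'h) \<Rightarrow> bool"
  where "adjoint_on H T T' \<longleftrightarrow> (\<forall>x\<in>H. \<forall>y\<in>H. cinner (T x) y = cinner x (T' y))"

definition scalar_ops :: "'h::complex_hilbert set \<Rightarrow> ('h \<Rightarrow> 'h) set"
  where "scalar_ops H = {(\<lambda>x\<in>H. c *\<^sub>C x) |c. True}"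

text \<open>On a Hilbert space every bounded operator has an adjoint, so the last clause below is closure
  under adjoints.\<close>

definition star_subalgebra_on :: "'h::complex_hilbert set \<Rightarrow> ('h \<Rightarrow> 'h) set \<Rightarrow> bool"
  where "star_subalgebra_on H A \<longleftrightarrow> A \<subseteq> bounded_ops H \<and> (\<lambda>x\<in>H. x) \<in> A \<and>
    (\<forall>S\<in>A. \<forall>T\<in>A. (\<lambda>x\<in>H. S x + T x) \<in> A) \<and>
    (\<forall>c. \<forall>T\<in>A. (\<lambda>x\<in>H. c *\<^sub>C T x) \<in> A) \<and>
    (\<forall>S\<in>A. \<forall>T\<in>A. compose H S T \<in> A) \<and>
    (\<forall>T\<in>A. \<forall>T'\<in>bounded_ops H. adjoint_on H T T' \<longrightarrow> T' \<in> A)"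

definition star_isomorphic_on :: "'h::complex_hilbert set \<Rightarrow> ('h \<Rightarrow> 'h) set \<Rightarrow> ('h \<Rightarrow> 'h) set \<Rightarrow> bool"
  where "star_isomorphic_on H A B \<longleftrightarrow> (\<exists>\<Phi>. bij_betw \<Phi> A B \<and> \<Phi> (\<lambda>x\<in>H. x) = (\<lambda>x\<in>H. x) \<and>
    (\<forall>S\<in>A. \<forall>T\<in>A. \<Phi> (\<lambda>x\<in>H. S x + T x) = (\<lambda>x\<in>H. \<Phi> S x + \<Phi> T x)) \<and>
    (\<forall>c. \<forall>T\<in>A. \<Phi> (\<lambda>x\<in>H. c *\<^sub>C T x) = (\<lambda>x\<in>H. c *\<^sub>C \<Phi> T x)) \<and>
    (\<forall>S\<in>A. \<forall>T\<in>A. \<Phi> (compose H S T) = compose H (\<Phi> S) (\<Phi> T)) \<and>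
    (\<forall>S\<in>A. \<forall>T\<in>A. adjoint_on H S T \<longrightarrow> adjoint_on H (\<Phi> S) (\<Phi> T)))"

section \<open>Ideal frames\<close>

text \<open>The finite abelian group is a type \<^typ>\<open>'g\<close>, written additively; \<open>\<ell>\<^sup>2\<close> of it is
  \<^typ>\<open>(complex, 'g) vec\<close>.\<close>

type_synonym 'g l2 = "(complex, 'g) vec"

definition ket :: "'g::finite \<Rightarrow> 'g l2"
  where "ket g = axis g 1"

definition ketbra :: "'g::finite \<Rightarrow> 'g l2 \<Rightarrow> 'g l2"
  where "ketbra g \<phi> = cinner (ket g) \<phi> *\<^sub>C ket g"

definition regular :: "'g::{finite, ab_group_add} \<Rightarrow> 'g l2 \<Rightarrow> 'g l2"
  where "regular g \<phi> = (\<Sum>g'\<in>UNIV. (\<phi> $ g') *\<^sub>C ket (g + g'))"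

definition unitary_rep :: "('g::ab_group_add \<Rightarrow> 'h::complex_hilbert \<Rightarrow> 'h) \<Rightarrow> bool"
  where "unitary_rep U \<longleftrightarrow>
    (\<forall>g. U g \<in> bounded_ops UNIV \<and> surj (U g) \<and> (\<forall>x y. cinner (U g x) (U g y) = cinner x y)) \<and>
    U 0 = id \<and> (\<forall>g h. U (g + h) = U g \<circ> U h)"

section \<open>The kinematical space\<close>

text \<open>The tensor product of two copies of \<^typ>\<open>'g l2\<close> with \<^typ>\<open>'h\<close> is realised as
  \<^typ>\<open>('h, 'g \<times> 'g) vec\<close>: the vector \<open>\<psi>\<close> stands for the sum over \<open>a, b\<close> of
  \<open>ket a \<otimes> ket b \<otimes> (\<psi> $ (a, b))\<close>. The lemmas \<open>tensor_expansion\<close>, \<open>cinner_tensor\<close> and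
  \<open>tensor_op_tensor\<close> confirm that this is the tensor product of Hilbert spaces and of operators.\<close>

type_synonym ('g, 'h) kin = "('h, 'g \<times> 'g) vec"

definition tensor :: "'g l2 \<Rightarrow> 'g l2 \<Rightarrow> 'h::complex_hilbert \<Rightarrow> ('g::finite, 'h) kin"
  where "tensor \<phi>\<^sub>1 \<phi>\<^sub>2 v = (\<chi> p. (\<phi>\<^sub>1 $ fst p * \<phi>\<^sub>2 $ snd p) *\<^sub>C v)"

definition tensor_op :: "('g l2 \<Rightarrow> 'g l2) \<Rightarrow> ('g l2 \<Rightarrow> 'g l2) \<Rightarrow>
    ('h \<Rightarrow> 'h) \<Rightarrow> ('g::finite, 'h::complex_hilbert) kin \<Rightarrow> ('g, 'h) kin"
  where "tensor_op A B F \<psi> =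
    (\<Sum>a\<in>UNIV. \<Sum>b\<in>UNIV. tensor (A (ket a)) (B (ket b)) (F (\<psi> $ (a, b))))"

definition U_kin :: "('g::{finite, ab_group_add} \<Rightarrow> 'h::complex_hilbert \<Rightarrow> 'h) \<Rightarrow> 'g \<Rightarrow>
    ('g, 'h) kin \<Rightarrow> ('g, 'h) kin"
  where "U_kin U g = tensor_op (regular g) (regular g) (U g)"

definition Pi_phys :: "('g::{finite, ab_group_add} \<Rightarrow> 'h::complex_hilbert \<Rightarrow> 'h) \<Rightarrow>
    ('g, 'h) kin \<Rightarrow> ('g, 'h) kin"
  where "Pi_phys U \<psi> = (1 / of_nat CARD('g)) *\<^sub>C (\<Sum>g\<in>UNIV. U_kin U g \<psi>)"

definition H_phys :: "('g::{finite, ab_group_add} \<Rightarrow> 'h::complex_hilbert \<Rightarrow> 'h) \<Rightarrow> ('g, 'h) kin set"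
  where "H_phys U = range (Pi_phys U)"

section \<open>Relational observables\<close>

definition rel_obs1 :: "('g::{finite, ab_group_add} \<Rightarrow> 'h::complex_hilbert \<Rightarrow> 'h) \<Rightarrow> 'g \<Rightarrow> ('h \<Rightarrow> 'h) \<Rightarrow>
    ('g, 'h) kin \<Rightarrow> ('g, 'h) kin"
  where "rel_obs1 U g f =
    (\<lambda>\<psi>\<in>H_phys U. of_nat CARD('g) *\<^sub>C Pi_phys U (tensor_op (ketbra g) id f (Pi_phys U \<psi>)))"

definition rel_obs2 :: "('g::{finite, ab_group_add} \<Rightarrow> 'h::complex_hilbert \<Rightarrow> 'h) \<Rightarrow> 'g \<Rightarrow> ('h \<Rightarrow> 'h) \<Rightarrow>
    ('g, 'h) kin \<Rightarrow> ('g, 'h) kin"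
  where "rel_obs2 U g f =
    (\<lambda>\<psi>\<in>H_phys U. of_nat CARD('g) *\<^sub>C Pi_phys U (tensor_op id (ketbra g) f (Pi_phys U \<psi>)))"

definition rel_alg1 :: "('g::{finite, ab_group_add} \<Rightarrow> 'h::complex_hilbert \<Rightarrow> 'h) \<Rightarrow> 'g \<Rightarrow>
    (('g, 'h) kin \<Rightarrow> ('g, 'h) kin) set"
  where "rel_alg1 U g = rel_obs1 U g ` bounded_ops UNIV"

definition rel_alg2 :: "('g::{finite, ab_group_add} \<Rightarrow> 'h::complex_hilbert \<Rightarrow> 'h) \<Rightarrow> 'g \<Rightarrow>
    (('g, 'h) kin \<Rightarrow> ('g, 'h) kin) set"
  where "rel_alg2 U g = rel_obs2 U g ` bounded_ops UNIV"

definition invariant_ops :: "('g \<Rightarrow> 'h::complex_hilbert \<Rightarrow> 'h) \<Rightarrow> ('h \<Rightarrow> 'h) set"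
  where "invariant_ops U = {f \<in> bounded_ops UNIV. \<forall>g. f \<circ> U g = U g \<circ> f}"

section \<open>Consistency of the tensor product model\<close>

lemma scaleC_zero_left: "0 *\<^sub>C (x::'h::complex_hilbert) = 0"
  by (metis scaleR_scaleC of_real_0 scaleR_zero_left)

lemma scaleC_one: "1 *\<^sub>C (x::'h::complex_hilbert) = x"
  by (metis scaleR_scaleC of_real_1 scaleR_one)

lemma scaleC_sum_left:
  "sum f A *\<^sub>C (x::'h::complex_hilbert) = (\<Sum>i\<in>A. f i *\<^sub>C x)"
  by (induction A rule: infinite_finite_induct) (simp_all add: scaleC_zero_left scaleC_add_left)

lemma cinner_scaleC_left: "cinner (c *\<^sub>C x) (y::'h::complex_hilbert) = cnj c * cinner x y"
  by (metis cinner_commute cinner_scaleC_right complex_cnj_mult)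

lemma ket_nth: "ket g $ h = (if h = g then 1 else 0)"
  by (simp add: ket_def axis_def)

lemma cinner_ket: "cinner (ket g) (ket h) = (if g = h then 1 else 0)"
proof -
  have "cinner (ket g) (ket h) = (\<Sum>i\<in>UNIV. if i = g then (if g = h then 1 else 0) else 0)"
    unfolding cinner_vec_def by (rule sum.cong) (auto simp: cinner_complex_def ket_nth)
  then show ?thesis by simp
qed

lemma regular_ket: "regular g (ket h) = ket (g + h)"
  by (simp add: regular_def ket_nth vec_eq_iff scaleC_vec_def scaleC_complex_def if_distribR
      if_distrib[of "\<lambda>c. c * _"] cong: if_cong)

lemma tensor_expansion:
  fixes \<psi> :: "('g::finite, 'h::complex_hilbert) kin"
  shows "\<psi> = (\<Sum>a\<in>UNIV. \<Sum>b\<in>UNIV. tensor (ket a) (ket b) (\<psi> $ (a, b)))"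
proof -
  have "(\<Sum>a\<in>UNIV. \<Sum>b\<in>UNIV. (ket a $ i * ket b $ j) *\<^sub>C (\<psi> $ (a, b))) = \<psi> $ (i, j)" for i j
  proof -
    have "(\<Sum>a\<in>UNIV. \<Sum>b\<in>UNIV. (ket a $ i * ket b $ j) *\<^sub>C (\<psi> $ (a, b))) =
        (\<Sum>a\<in>UNIV. \<Sum>b\<in>UNIV. if b = j then (if a = i then \<psi> $ (a, b) else 0) else 0)"
      by (intro sum.cong refl) (auto simp: ket_nth scaleC_zero_left scaleC_one)
    then show ?thesis by simp
  qed
  then show ?thesis by (simp add: vec_eq_iff tensor_def)
qed

lemma cinner_tensor:
  "cinner (tensor \<phi>\<^sub>1 \<phi>\<^sub>2 v) (tensor \<xi>\<^sub>1 \<xi>\<^sub>2 w) = cinner \<phi>\<^sub>1 \<xi>\<^sub>1 * cinner \<phi>\<^sub>2 \<xi>\<^sub>2 * cinner v w"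
proof -
  have "cinner (tensor \<phi>\<^sub>1 \<phi>\<^sub>2 v) (tensor \<xi>\<^sub>1 \<xi>\<^sub>2 w) =
      (\<Sum>(a, b)\<in>UNIV \<times> UNIV. (cnj (\<phi>\<^sub>1 $ a) * \<xi>\<^sub>1 $ a) * (cnj (\<phi>\<^sub>2 $ b) * \<xi>\<^sub>2 $ b) * cinner v w)"
    unfolding cinner_vec_def tensor_def UNIV_Times_UNIV
    by (intro sum.cong refl) (auto simp: cinner_scaleC_left cinner_scaleC_right)
  also have "\<dots> = cinner \<phi>\<^sub>1 \<xi>\<^sub>1 * cinner \<phi>\<^sub>2 \<xi>\<^sub>2 * cinner v w"
    unfolding cinner_vec_def cinner_complex_def
    by (simp only: sum.cartesian_product[symmetric] sum_distrib_left sum_distrib_right)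
      (rule sum.swap)
  finally show ?thesis .
qed

lemma ket_expansion: "\<phi> = (\<Sum>a\<in>UNIV. (\<phi> $ a) *\<^sub>C ket a)"
  by (simp add: vec_eq_iff ket_nth scaleC_vec_def scaleC_complex_def if_distrib[of "\<lambda>c. _ * c"]
      cong: if_cong)

lemma bounded_ops_ket_expansion:
  assumes "A \<in> bounded_ops UNIV"
  shows "A \<phi> $ i = (\<Sum>a\<in>UNIV. \<phi> $ a * A (ket a) $ i)"
proof -
  from assms have lin: "linear A" and sc: "A (c *\<^sub>C x) = c *\<^sub>C A x" for c x
    by (auto simp: bounded_ops_UNIV bounded_linear.linear)
  have "A \<phi> = A (\<Sum>a\<in>UNIV. (\<phi> $ a) *\<^sub>C ket a)"
    using ket_expansion[of \<phi>] by simp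
  also have "\<dots> = (\<Sum>a\<in>UNIV. (\<phi> $ a) *\<^sub>C A (ket a))"
    by (simp add: linear_sum[OF lin] sc)
  finally show ?thesis by (simp add: scaleC_vec_def scaleC_complex_def)
qed

lemma tensor_op_tensor:
  assumes "A \<in> bounded_ops UNIV" "B \<in> bounded_ops UNIV" "F \<in> bounded_ops UNIV"
  shows "tensor_op A B F (tensor \<phi>\<^sub>1 \<phi>\<^sub>2 v) = tensor (A \<phi>\<^sub>1) (B \<phi>\<^sub>2) (F v)"
proof -
  have sc: "F (c *\<^sub>C x) = c *\<^sub>C F x" for c x
    using assms(3) by (auto simp: bounded_ops_UNIV)
  have "tensor_op A B F (tensor \<phi>\<^sub>1 \<phi>\<^sub>2 v) $ (i, j) = tensor (A \<phi>\<^sub>1) (B \<phi>\<^sub>2) (F v) $ (i, j)" for i j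
    by (simp add: tensor_op_def tensor_def sc scaleC_scaleC scaleC_sum_left[symmetric] sum_product
        bounded_ops_ket_expansion[OF assms(1), of \<phi>\<^sub>1] bounded_ops_ket_expansion[OF assms(2), of \<phi>\<^sub>2]
        mult_ac)
  then show ?thesis by (simp add: vec_eq_iff)
qed

end

theory Submission
  imports Defs
begin

text \<open>Physical vectors are the \<open>\<psi>\<close> with \<open>\<psi>(k + a, k + b) = U k (\<psi>(a, b))\<close>, and on them a
  relational observable acts fibrewise: relative to the first frame it multiplies the fibre over
  \<open>(a, b)\<close> by the conjugate of \<open>f\<close> under \<open>U (a - g)\<close>, relative to the second by the conjugate under
  \<open>U (b - g)\<close>. A fibre over \<open>q\<close> can be prescribed arbitrarily, by spreading a vector along the
  diagonal orbit of \<open>q\<close>. So \<open>f\<close> can be read off from its observable, and an operator is an observable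
  for both frames only if conjugation with \<open>U\<close> leaves \<open>f\<close> fixed. Rank-one operators witness
  that the algebras differ and that the overlap is more than the scalars.\<close>

section \<open>Hilbert space preliminaries\<close>

lemma scaleC_zero_right [simp]: "c *\<^sub>C (0::'h::complex_hilbert) = 0"
  using scaleC_add_right[of c "0::'h" 0] by simp

lemma cinner_zero_right [simp]: "cinner (x::'h::complex_hilbert) 0 = 0"
  using cinner_add_right[of x 0 0] by simp

lemma cinner_zero_left [simp]: "cinner 0 (x::'h::complex_hilbert) = 0"
  by (metis cinner_commute cinner_zero_right complex_cnj_zero)

lemma cinner_diff_right: "cinner (x::'h::complex_hilbert) (y - z) = cinner x y - cinner x z"
  using cinner_add_right[of x "y - z" z] by simp

lemma cinner_self_eq_0_iff [simp]: "cinner (x::'h::complex_hilbert) x = 0 \<longleftrightarrow> x = 0"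
  by (simp add: cinner_self)

lemma cinner_ext:
  fixes y z :: "'h::complex_hilbert"
  assumes "\<And>x. cinner x y = cinner x z"
  shows "y = z"
proof -
  have "cinner (y - z) (y - z) = 0"
    using assms by (simp add: cinner_diff_right)
  then show ?thesis by simp
qed

lemma scaleC_nth [simp]: "(c *\<^sub>C x) $ i = c *\<^sub>C (x $ i)"
  by (simp add: scaleC_vec_def)

lemma bounded_opsI:
  assumes "\<And>x y. T (x + y) = T x + T y" "\<And>c x. T (c *\<^sub>C x) = c *\<^sub>C T x"
    and "\<And>x. norm (T x) \<le> norm x * K"
  shows "T \<in> bounded_ops UNIV"
  using assms by (auto simp: bounded_ops_def)

lemma bounded_opsD:
  assumes "T \<in> bounded_ops UNIV"
  shows "bounded_linear T" "T (x + y) = T x + T y" "T (c *\<^sub>C x) = c *\<^sub>C T x" "T 0 = 0"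
  using assms by (auto simp: bounded_ops_UNIV linear_simps)

lemma bounded_ops_id: "(\<lambda>x. x) \<in> bounded_ops UNIV"
  by (simp add: bounded_ops_UNIV)

lemma bounded_ops_add:
  assumes "S \<in> bounded_ops UNIV" "T \<in> bounded_ops UNIV"
  shows "(\<lambda>x. S x + T x) \<in> bounded_ops UNIV"
  using assms by (auto simp: bounded_ops_UNIV scaleC_add_right bounded_linear_add)

text \<open>The class gives homogeneity of the norm for real scalars only; the complex case comes
  from expanding the inner product of \<open>c *\<^sub>C x\<close> with itself.\<close>

lemma norm_scaleC: "norm (c *\<^sub>C (x::'h::complex_hilbert)) = cmod c * norm x"
proof -
  have "complex_of_real ((norm (c *\<^sub>C x))\<^sup>2) = complex_of_real ((cmod c * norm x)\<^sup>2)"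
    by (simp add: cinner_self[symmetric] cinner_scaleC_left cinner_scaleC_right power_mult_distrib
        complex_norm_square cinner_complex_def mult_ac flip: of_real_power)
  then show ?thesis
    by (simp only: of_real_eq_iff) (simp add: power2_eq_iff_nonneg)
qed

lemma bounded_ops_scaleC:
  assumes "T \<in> bounded_ops UNIV"
  shows "(\<lambda>x. c *\<^sub>C T x) \<in> bounded_ops UNIV"
proof -
  obtain K where "\<And>x. norm (T x) \<le> norm x * K"
    using bounded_linear.bounded[OF bounded_opsD(1)[OF assms]] by blast
  then have "norm (c *\<^sub>C T x) \<le> norm x * (cmod c * K)" for x
    using mult_left_mono[of "norm (T x)" "norm x * K" "cmod c"] by (simp add: norm_scaleC mult_ac)
  then show ?thesis
    using bounded_opsD[OF assms] by (intro bounded_opsI[where K = "cmod c * K"]) (auto simp: scaleC_add_right scaleC_scaleC mult_ac)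
qed

lemma bounded_ops_compose:
  assumes "S \<in> bounded_ops UNIV" "T \<in> bounded_ops UNIV"
  shows "(\<lambda>x. S (T x)) \<in> bounded_ops UNIV"
  using assms by (auto simp: bounded_ops_UNIV bounded_linear_compose)

text \<open>Expand the nonnegative squared norm of \<open>\<parallel>x\<parallel>\<^sup>2 y - \<langle>x, y\<rangle> x\<close>.\<close>

lemma cmod_cinner_le: "cmod (cinner x y) \<le> norm x * norm (y::'h::complex_hilbert)"
proof (cases "x = 0")
  case False
  define z where "z = cinner x x *\<^sub>C y - cinner x y *\<^sub>C x"
  have "cinner x z = 0"
    by (simp add: z_def cinner_diff_right cinner_scaleC_right)
  then have "cinner z x = 0"
    by (metis cinner_commute complex_cnj_zero)
  then have "cinner z z = cinner x x * cinner z y"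
    by (subst (2) z_def) (simp add: cinner_diff_right cinner_scaleC_right)
  also have "cinner z y = cnj (cinner y z)"
    by (rule cinner_commute)
  also have "cinner y z = cinner x x * cinner y y - cinner x y * cinner y x"
    by (simp add: z_def cinner_diff_right cinner_scaleC_right)
  also have "cinner x y * cinner y x = complex_of_real ((cmod (cinner x y))\<^sup>2)"
    by (metis cinner_commute complex_norm_square)
  finally have "complex_of_real ((norm z)\<^sup>2) =
      complex_of_real ((norm x)\<^sup>2 * ((norm x)\<^sup>2 * (norm y)\<^sup>2 - (cmod (cinner x y))\<^sup>2))"
    by (simp add: cinner_self)
  then have "(norm z)\<^sup>2 = (norm x)\<^sup>2 * ((norm x)\<^sup>2 * (norm y)\<^sup>2 - (cmod (cinner x y))\<^sup>2)"
    by (simp only: of_real_eq_iff)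
  then have "0 \<le> (norm x)\<^sup>2 * ((norm x)\<^sup>2 * (norm y)\<^sup>2 - (cmod (cinner x y))\<^sup>2)"
    by (metis zero_le_power2)
  then have "(cmod (cinner x y))\<^sup>2 \<le> (norm x * norm y)\<^sup>2"
    using False by (simp add: zero_le_mult_iff power_mult_distrib)
  then show ?thesis
    by (rule power2_le_imp_le) simp
qed simp

section \<open>Rank-one operators\<close>

definition rank_one :: "'h::complex_hilbert \<Rightarrow> 'h \<Rightarrow> 'h \<Rightarrow> 'h"
  where "rank_one x y v = cinner y v *\<^sub>C x"

lemma rank_one_bounded: "rank_one x y \<in> bounded_ops UNIV"
proof (rule bounded_opsI)
  show "norm (rank_one x y v) \<le> norm v * (norm y * norm x)" for v
    using mult_right_mono[OF cmod_cinner_le[of y v], of "norm x"]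
    by (simp add: rank_one_def norm_scaleC mult_ac)
qed (simp_all add: rank_one_def cinner_add_right cinner_scaleC_right scaleC_add_left scaleC_scaleC)

lemma scaleC_inverse_cinner:
  assumes "(x::'h::complex_hilbert) \<noteq> 0" "cinner x x *\<^sub>C v = w"
  shows "v = (1 / cinner x x) *\<^sub>C w"
  using assms(1) by (simp add: assms(2)[symmetric] scaleC_scaleC scaleC_one)

text \<open>Evaluating the commutation at a fixed nonzero \<open>y\<close> exhibits
  \<open>V x\<close> as a multiple of \<open>x\<close>, with a coefficient that depends on
  \<open>V\<close> and \<open>y\<close> but not on \<open>x\<close>.\<close>

lemma commuting_rank_ones_imp_scalar:
  fixes V :: "'h::complex_hilbert \<Rightarrow> 'h"
  assumes V: "V \<in> bounded_ops UNIV"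
    and comm: "\<And>x y. rank_one x y \<circ> V = V \<circ> rank_one x y"
  shows "\<exists>c. V = (\<lambda>v. c *\<^sub>C v)"
proof (cases "\<forall>y::'h. y = 0")
  case True
  then have "V = (\<lambda>v. 0 *\<^sub>C v)"
    by (intro ext) metis
  then show ?thesis by blast
next
  case False
  then obtain y :: 'h where y: "y \<noteq> 0" by blast
  have "V x = (cinner y (V y) / cinner y y) *\<^sub>C x" for x
  proof -
    have "cinner y y *\<^sub>C V x = cinner y (V y) *\<^sub>C x"
      using fun_cong[OF comm[of x y], of y] by (simp add: rank_one_def bounded_opsD(3)[OF V])
    from scaleC_inverse_cinner[OF y this] show ?thesis
      by (simp add: scaleC_scaleC)
  qed
  then show ?thesis by blast
qed

lemma rank_one_not_scalar:
  fixes x y :: "'h::complex_hilbert"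
  assumes "x \<noteq> 0" "\<And>c. y \<noteq> c *\<^sub>C x"
  shows "rank_one x x \<noteq> (\<lambda>v. c *\<^sub>C v)"
proof
  assume eq: "rank_one x x = (\<lambda>v. c *\<^sub>C v)"
  have "(cinner x x - c) *\<^sub>C x = 0"
    using fun_cong[OF eq, of x] scaleC_add_left[of "cinner x x - c" c x] by (simp add: rank_one_def)
  then have "c = cinner x x"
    using assms(1) norm_scaleC[of "cinner x x - c" x] by simp
  then have "cinner x x *\<^sub>C y = cinner x y *\<^sub>C x"
    using fun_cong[OF eq, of y] by (simp add: rank_one_def)
  from scaleC_inverse_cinner[OF assms(1) this] show False
    using assms(2) by (simp add: scaleC_scaleC)
qed

section \<open>Components of operators on the kinematical space\<close>

text \<open>Each row of the matrices of \<open>A\<close> and \<open>B\<close> has at most one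
  nonzero entry, so the double sum collapses. Identities, translations and \<open>ketbra\<close> are
  all of this kind.\<close>

lemma tensor_op_nth:
  assumes "\<And>a i. A (ket a) $ i = (if a = \<alpha> i then c i else 0)"
    and "\<And>b j. B (ket b) $ j = (if b = \<beta> j then d j else 0)"
  shows "tensor_op A B F \<psi> $ (i, j) = (c i * d j) *\<^sub>C F (\<psi> $ (\<alpha> i, \<beta> j))"
proof -
  have "tensor_op A B F \<psi> $ (i, j) = (\<Sum>a\<in>UNIV. \<Sum>b\<in>UNIV.
      if b = \<beta> j then (if a = \<alpha> i then (c i * d j) *\<^sub>C F (\<psi> $ (a, b)) else 0) else 0)"
    unfolding tensor_op_def tensor_def sum_component vec_lambda_beta fst_conv snd_conv
    by (intro sum.cong refl) (simp add: assms scaleC_zero_left)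
  then show ?thesis by simp
qed

text \<open>The redundant abstractions here and in the next two lemmas let unification read off
  \<open>\<alpha>\<close> and \<open>c\<close> in \<open>tensor_op_nth\<close>.\<close>

lemma id_ket_nth: "id (ket a) $ i = (if a = id i then (\<lambda>_. 1) i else 0)"
  by (simp add: ket_nth)

lemma regular_ket_nth: "regular g (ket a) $ i = (if a = (\<lambda>i. i - g) i then (\<lambda>_. 1) i else 0)"
  by (auto simp: regular_ket ket_nth algebra_simps)

lemma ketbra_ket_nth:
  "ketbra g (ket a) $ i = (if a = (\<lambda>_. g) i then (\<lambda>i. if i = g then 1 else 0) i else 0)"
  by (auto simp: ketbra_def cinner_ket ket_nth scaleC_complex_def)

lemma tensor_op_id_nth: "tensor_op id id F \<psi> $ q = F (\<psi> $ q)"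
  by (cases q) (simp add: tensor_op_nth[OF id_ket_nth id_ket_nth] scaleC_one)

lemma reorient1_nth: "tensor_op (regular g) id id \<psi> $ q = \<psi> $ (q - (g, 0))"
  by (cases q) (simp add: tensor_op_nth[OF regular_ket_nth id_ket_nth] scaleC_one)

lemma reorient2_nth: "tensor_op id (regular g) id \<psi> $ q = \<psi> $ (q - (0, g))"
  by (cases q) (simp add: tensor_op_nth[OF id_ket_nth regular_ket_nth] scaleC_one)

lemma U_kin_nth: "U_kin U g \<psi> $ q = U g (\<psi> $ (q - (g, g)))"
  by (cases q) (simp add: U_kin_def tensor_op_nth[OF regular_ket_nth regular_ket_nth] scaleC_one)

lemma tensor_op_ketbra1_nth:
  "tensor_op (ketbra g) id f \<psi> $ q = (if fst q = g then f (\<psi> $ q) else 0)"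
  by (cases q) (auto simp: tensor_op_nth[OF ketbra_ket_nth id_ket_nth] scaleC_one scaleC_zero_left)

lemma tensor_op_ketbra2_nth:
  "tensor_op id (ketbra g) f \<psi> $ q = (if snd q = g then f (\<psi> $ q) else 0)"
  by (cases q) (auto simp: tensor_op_nth[OF id_ket_nth ketbra_ket_nth] scaleC_one scaleC_zero_left)

text \<open>The prefactor of a relational observable cancels the normalisation of the
  projector.\<close>

lemma card_scaleC_Pi_phys_nth:
  fixes U :: "'g::{finite, ab_group_add} \<Rightarrow> 'h::complex_hilbert \<Rightarrow> 'h"
  shows "(of_nat CARD('g) *\<^sub>C Pi_phys U \<psi>) $ q = (\<Sum>k\<in>UNIV. U k (\<psi> $ (q - (k, k))))"
  by (simp add: Pi_phys_def scaleC_scaleC scaleC_one U_kin_nth)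

section \<open>Physical vectors and fibrewise observables\<close>

text \<open>Such a \<open>p\<close> plays the role of the orientation reading of a frame.
  Equivariance under diagonal translations lets one argument serve both \<open>fst\<close> and
  \<open>snd\<close>.\<close>

definition covariant :: "('g::ab_group_add \<times> 'g \<Rightarrow> 'g) \<Rightarrow> bool"
  where "covariant p \<longleftrightarrow> (\<forall>k q. p ((k, k) + q) = k + p q)"

lemma covariant_fst: "covariant fst" and covariant_snd: "covariant snd"
  by (simp_all add: covariant_def)

text \<open>For covariant \<open>p\<close>, \<open>U (g - p q)\<close> carries the fibre over
  \<open>q\<close> to the point of its diagonal orbit where the frame reads \<open>g\<close>; there
  \<open>f\<close> acts unconjugated.\<close>

definition frame_obs :: "('g::{finite, ab_group_add} \<Rightarrow> 'h::complex_hilbert \<Rightarrow> 'h) \<Rightarrow>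
    ('g \<times> 'g \<Rightarrow> 'g) \<Rightarrow> 'g \<Rightarrow> ('h \<Rightarrow> 'h) \<Rightarrow> ('g, 'h) kin \<Rightarrow> ('g, 'h) kin"
  where "frame_obs U p g f =
    (\<lambda>\<psi>\<in>H_phys U. \<chi> q. U (p q - g) (f (U (g - p q) (\<psi> $ q))))"

text \<open>Up to the factor \<open>CARD('g)\<close>, this is the projection by
  \<open>Pi_phys\<close> of the product vector with frames at \<open>q\<close> and system in
  \<open>v\<close>.\<close>

definition orbit_vec :: "('g::{finite, ab_group_add} \<Rightarrow> 'h::complex_hilbert \<Rightarrow> 'h) \<Rightarrow>
    'g \<times> 'g \<Rightarrow> 'h \<Rightarrow> ('g, 'h) kin"
  where "orbit_vec U q v =
    (\<chi> r. if fst r - fst q = snd r - snd q then U (fst r - fst q) v else 0)"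

definition diag_orbit :: "'g::ab_group_add \<times> 'g \<Rightarrow> ('g \<times> 'g) set"
  where "diag_orbit q = {r. fst r - fst q = snd r - snd q}"

lemma card_diag_orbit: "card (diag_orbit (q::'g::{finite, ab_group_add} \<times> 'g)) \<noteq> 0"
proof -
  have "q \<in> diag_orbit q" by (simp add: diag_orbit_def)
  then show ?thesis by (auto simp: card_eq_0_iff)
qed

context
  fixes U :: "'g::{finite, ab_group_add} \<Rightarrow> 'h::complex_hilbert \<Rightarrow> 'h"
  assumes rep: "unitary_rep U"
begin

section \<open>The representation and the physical subspace\<close>

lemma U_bounded: "U g \<in> bounded_ops UNIV"
  using rep by (simp add: unitary_rep_def)

lemmas U_add = bounded_opsD(2)[OF U_bounded]
  and U_scaleC = bounded_opsD(3)[OF U_bounded]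
  and U_zero = bounded_opsD(4)[OF U_bounded]

lemma U_0 [simp]: "U 0 v = v"
  using rep by (simp add: unitary_rep_def)

lemma U_U: "U a (U b v) = U (a + b) v"
  using rep by (simp add: unitary_rep_def)

lemma cinner_U_U: "cinner (U g v) (U g w) = cinner v w"
  using rep by (simp add: unitary_rep_def)

lemma cinner_U_left: "cinner (U a v) w = cinner v (U (- a) w)"
  using cinner_U_U[of a v "U (- a) w"] by (simp add: U_U)

lemma norm_U: "norm (U g v) = norm v"
proof -
  have "complex_of_real ((norm (U g v))\<^sup>2) = complex_of_real ((norm v)\<^sup>2)"
    by (metis cinner_self cinner_U_U)
  then show ?thesis
    by (simp only: of_real_eq_iff) (simp add: power2_eq_iff_nonneg)
qed

lemma sum_U_shift_physical:
  assumes "\<And>k q. \<psi> $ ((k, k) + q) = U k (\<psi> $ q)"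
  shows "(\<Sum>k\<in>UNIV. U k (\<psi> $ (q - (k, k)))) = of_nat CARD('g) *\<^sub>C (\<psi> $ q)"
proof -
  have "U k (\<psi> $ (q - (k, k))) = 1 *\<^sub>C (\<psi> $ q)" for k
    using assms[of k "q - (k, k)"] by (simp add: scaleC_one)
  then show ?thesis
    using scaleC_sum_left[of "\<lambda>_. 1" "UNIV :: 'g set" "\<psi> $ q"] by simp
qed

lemma Pi_phys_fixed:
  assumes "\<And>k q. \<psi> $ ((k, k) + q) = U k (\<psi> $ q)"
  shows "Pi_phys U \<psi> = \<psi>"
proof -
  have "Pi_phys U \<psi> $ q = \<psi> $ q" for q
  proof -
    have "Pi_phys U \<psi> $ q = (1 / of_nat CARD('g)) *\<^sub>C ((of_nat CARD('g) *\<^sub>C Pi_phys U \<psi>) $ q)"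
      by (simp add: scaleC_scaleC scaleC_one)
    also have "\<dots> = \<psi> $ q"
      by (simp only: card_scaleC_Pi_phys_nth sum_U_shift_physical[OF assms])
        (simp add: scaleC_scaleC scaleC_one)
    finally show ?thesis .
  qed
  then show ?thesis by (simp add: vec_eq_iff)
qed

lemma U_sum: "U k (\<Sum>a\<in>A. F a) = (\<Sum>a\<in>A. U k (F a))"
  using bounded_opsD(1)[OF U_bounded] by (intro linear_sum) (rule bounded_linear.linear)

text \<open>Averaging over the group produces covariance by a shift of the summation index;
  conversely, covariant vectors are fixed by the projector.\<close>

lemma H_phys_iff: "\<psi> \<in> H_phys U \<longleftrightarrow> (\<forall>k q. \<psi> $ ((k, k) + q) = U k (\<psi> $ q))"
proof
  assume "\<psi> \<in> H_phys U"
  then obtain \<phi> where \<phi>: "\<psi> = Pi_phys U \<phi>" by (auto simp: H_phys_def)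
  have nth: "\<psi> $ q = (1 / of_nat CARD('g)) *\<^sub>C (\<Sum>l\<in>UNIV. U l (\<phi> $ (q - (l, l))))" for q
    by (simp add: \<phi> Pi_phys_def U_kin_nth)
  have idx: "q - (l - k, l - k) = (k, k) + q - (l, l)" for k l :: 'g and q
    by (simp add: prod_eq_iff)
  \<comment> \<open>Substituting \<open>k + l\<close> for \<open>l\<close> moves \<open>k\<close>
    from the fibre index into the group element.\<close>
  have shift: "(\<Sum>l\<in>UNIV. U l (\<phi> $ ((k, k) + q - (l, l)))) =
      (\<Sum>l\<in>UNIV. U (k + l) (\<phi> $ (q - (l, l))))" for k q
    by (rule sum.reindex_bij_witness[where i = "\<lambda>l. k + l" and j = "\<lambda>l. l - k"])
      (auto simp: algebra_simps idx)
  show "\<forall>k q. \<psi> $ ((k, k) + q) = U k (\<psi> $ q)"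
    by (simp only: nth shift) (simp add: U_scaleC U_sum U_U)
next
  assume "\<forall>k q. \<psi> $ ((k, k) + q) = U k (\<psi> $ q)"
  then have "Pi_phys U \<psi> = \<psi>"
    by (intro Pi_phys_fixed) blast
  then show "\<psi> \<in> H_phys U"
    by (metis H_phys_def rangeI)
qed

lemma H_physD: "\<psi> \<in> H_phys U \<Longrightarrow> \<psi> $ ((k, k) + q) = U k (\<psi> $ q)"
  \<comment> \<open>\<open>split_paired_All\<close> would split the quantified \<open>q\<close> into
    components.\<close>
  by (simp add: H_phys_iff del: split_paired_All)

lemma Pi_phys_H_phys: "\<psi> \<in> H_phys U \<Longrightarrow> Pi_phys U \<psi> = \<psi>"
  by (rule Pi_phys_fixed) (rule H_physD)

lemma H_phys_add: "\<psi> \<in> H_phys U \<Longrightarrow> \<phi> \<in> H_phys U \<Longrightarrow> \<psi> + \<phi> \<in> H_phys U"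
  by (simp add: H_phys_iff U_add)

lemma H_phys_scaleC: "\<psi> \<in> H_phys U \<Longrightarrow> c *\<^sub>C \<psi> \<in> H_phys U"
  by (simp add: H_phys_iff U_scaleC)

text \<open>By covariance the condition holds for \<open>k = p q - g\<close> alone, and the physical
  vector supplies the inner \<open>U (- k)\<close> of the conjugation.\<close>

lemma sum_fibre_collapse:
  assumes p: "covariant p" and \<psi>: "\<psi> \<in> H_phys U"
  shows "(\<Sum>k\<in>UNIV. U k (if p (q - (k, k)) = g then f (\<psi> $ (q - (k, k))) else 0)) =
    U (p q - g) (f (U (g - p q) (\<psi> $ q)))"
proof -
  have pq: "p (q - (k, k)) = p q - k" for k
    using p by (metis add.commute add_diff_cancel_right' covariant_def diff_add_cancel)
  have \<psi>q: "\<psi> $ (q - (k, k)) = U (- k) (\<psi> $ q)" for k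
  proof -
    have "q - (k, k) = (- k, - k) + q"
      by (simp add: prod_eq_iff)
    then show ?thesis
      by (simp only: H_physD[OF \<psi>])
  qed
  have "(\<Sum>k\<in>UNIV. U k (if p (q - (k, k)) = g then f (\<psi> $ (q - (k, k))) else 0)) =
      (\<Sum>k\<in>UNIV. if k = p q - g then U k (f (U (- k) (\<psi> $ q))) else 0)"
    by (rule sum.cong) (auto simp: pq \<psi>q U_zero algebra_simps)
  then show ?thesis by simp
qed

lemma rel_obs1_eq: "rel_obs1 U g f = frame_obs U fst g f"
  unfolding rel_obs1_def frame_obs_def
proof (rule restrict_ext, unfold vec_eq_iff, rule allI)
  fix \<psi> :: "('g, 'h) kin" and q
  assume \<psi>: "\<psi> \<in> H_phys U"
  show "(of_nat CARD('g) *\<^sub>C Pi_phys U (tensor_op (ketbra g) id f (Pi_phys U \<psi>))) $ q =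
      (\<chi> q. U (fst q - g) (f (U (g - fst q) (\<psi> $ q)))) $ q"
    by (simp only: Pi_phys_H_phys[OF \<psi>] card_scaleC_Pi_phys_nth tensor_op_ketbra1_nth
        sum_fibre_collapse[OF covariant_fst \<psi>] vec_lambda_beta)
qed

lemma rel_obs2_eq: "rel_obs2 U g f = frame_obs U snd g f"
  unfolding rel_obs2_def frame_obs_def
proof (rule restrict_ext, unfold vec_eq_iff, rule allI)
  fix \<psi> :: "('g, 'h) kin" and q
  assume \<psi>: "\<psi> \<in> H_phys U"
  show "(of_nat CARD('g) *\<^sub>C Pi_phys U (tensor_op id (ketbra g) f (Pi_phys U \<psi>))) $ q =
      (\<chi> q. U (snd q - g) (f (U (g - snd q) (\<psi> $ q)))) $ q"
    by (simp only: Pi_phys_H_phys[OF \<psi>] card_scaleC_Pi_phys_nth tensor_op_ketbra2_nth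
        sum_fibre_collapse[OF covariant_snd \<psi>] vec_lambda_beta)
qed

section \<open>Orbit vectors and their inner products\<close>

lemma orbit_vec_H_phys: "orbit_vec U q v \<in> H_phys U"
  by (auto simp: H_phys_iff orbit_vec_def U_U U_zero algebra_simps)

lemma orbit_vec_self [simp]: "orbit_vec U q v $ q = v"
  by (simp add: orbit_vec_def)

lemma orbit_vec_add: "orbit_vec U q (v + w) = orbit_vec U q v + orbit_vec U q w"
  by (auto simp: orbit_vec_def vec_eq_iff U_add)

lemma orbit_vec_scaleC: "orbit_vec U q (c *\<^sub>C v) = c *\<^sub>C orbit_vec U q v"
  by (auto simp: orbit_vec_def vec_eq_iff U_scaleC)

text \<open>Along the orbit both vectors are transported by the same unitary, so every point
  contributes equally. Pairing with orbit vectors therefore tests a single fibre of a physical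
  vector.\<close>

lemma cinner_orbit_vec:
  assumes \<psi>: "\<psi> \<in> H_phys U"
  shows "cinner (orbit_vec U q v) \<psi> = of_nat (card (diag_orbit q)) * cinner v (\<psi> $ q)"
proof -
  have "cinner (orbit_vec U q v $ r) (\<psi> $ r) = (if r \<in> diag_orbit q then cinner v (\<psi> $ q) else 0)" for r
  proof (cases "r \<in> diag_orbit q")
    case True
    define k where "k = fst r - fst q"
    have r: "r = (k, k) + q"
      using True by (auto simp: k_def diag_orbit_def prod_eq_iff algebra_simps)
    have "orbit_vec U q v $ r = U k v"
      using True by (simp add: orbit_vec_def diag_orbit_def k_def)
    moreover have "\<psi> $ r = U k (\<psi> $ q)"
      unfolding r by (rule H_physD[OF \<psi>])
    ultimately show ?thesis
      using True by (simp add: cinner_U_U)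
  qed (simp add: orbit_vec_def diag_orbit_def)
  then show ?thesis
    by (simp add: cinner_vec_def sum.If_cases)
qed

lemma norm_orbit_vec: "norm (orbit_vec U q v) = sqrt (card (diag_orbit q)) * norm v"
proof -
  have "complex_of_real ((norm (orbit_vec U q v))\<^sup>2) =
      complex_of_real (real (card (diag_orbit q)) * (norm v)\<^sup>2)"
    by (subst cinner_self[symmetric], subst cinner_orbit_vec[OF orbit_vec_H_phys])
      (simp add: cinner_self)
  then have "(norm (orbit_vec U q v))\<^sup>2 = (sqrt (card (diag_orbit q)) * norm v)\<^sup>2"
    by (simp only: of_real_eq_iff) (simp add: power_mult_distrib)
  then show ?thesis
    by (simp add: power2_eq_iff_nonneg)
qed

lemma covariant_surj:
  fixes p :: "'g \<times> 'g \<Rightarrow> 'g"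
  assumes "covariant p"
  obtains q where "p q = g"
proof
  show "p ((g - p 0, g - p 0) + 0) = g"
    using assms by (metis covariant_def diff_add_cancel)
qed

section \<open>The algebra of one frame\<close>

lemma frame_obs_nth:
  "\<psi> \<in> H_phys U \<Longrightarrow> frame_obs U p g f \<psi> $ q = U (p q - g) (f (U (g - p q) (\<psi> $ q)))"
  by (simp add: frame_obs_def)

lemma frame_obs_orbit_vec: "frame_obs U p g f (orbit_vec U q v) $ q = U (p q - g) (f (U (g - p q) v))"
  by (simp add: frame_obs_nth orbit_vec_H_phys)

lemma frame_obs_eqI:
  assumes "T \<in> extensional (H_phys U)"
    and "\<And>\<psi> q. \<psi> \<in> H_phys U \<Longrightarrow> T \<psi> $ q = U (p q - g) (f (U (g - p q) (\<psi> $ q)))"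
  shows "T = frame_obs U p g f"
  using assms by (intro extensionalityI[of _ "H_phys U"]) (auto simp: frame_obs_def vec_eq_iff)

text \<open>Over a point with \<open>p q = g\<close> the conjugation is trivial, so an orbit vector
  reveals \<open>f\<close> itself.\<close>

lemma frame_obs_inject:
  assumes "covariant p" "frame_obs U p g f = frame_obs U p g h"
  shows "f = h"
proof
  fix v
  obtain q where "p q = g" using covariant_surj[OF assms(1)] .
  then show "f v = h v"
    using frame_obs_orbit_vec[of p g f q v] frame_obs_orbit_vec[of p g h q v] assms(2) by simp
qed

text \<open>A diagonal shift by \<open>k\<close> adds \<open>k\<close> to the outer group element
  and subtracts it from the inner one, where it cancels the \<open>U k\<close> of the physical
  vector.\<close>

lemma frame_obs_closed:
  assumes "covariant p" "\<psi> \<in> H_phys U"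
  shows "frame_obs U p g f \<psi> \<in> H_phys U"
proof -
  have "frame_obs U p g f \<psi> $ ((k, k) + q) = U k (frame_obs U p g f \<psi> $ q)" for k q
  proof -
    have "p ((k, k) + q) = k + p q"
      using assms(1) by (simp only: covariant_def)
    moreover have "k + p q - g = k + (p q - g)" "g - (k + p q) + k = g - p q"
      by simp_all
    ultimately show ?thesis
      by (simp only: frame_obs_nth[OF assms(2)] H_physD[OF assms(2)] U_U)
  qed
  then show ?thesis unfolding H_phys_iff by blast
qed

lemma frame_obs_bounded:
  assumes p: "covariant p" and f: "f \<in> bounded_ops UNIV"
  shows "frame_obs U p g f \<in> bounded_ops (H_phys U)"
proof -
  note f_simps = bounded_opsD(2,3)[OF f]
  \<comment> \<open>Nonnegativity is what allows \<open>K\<close> to be pulled out of the 2-norm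
    over the fibres.\<close>
  obtain K where K: "K \<ge> 0" "\<And>v. norm (f v) \<le> norm v * K"
    using bounded_linear.nonneg_bounded[OF bounded_opsD(1)[OF f]] by blast
  have "norm (frame_obs U p g f \<psi>) \<le> norm \<psi> * K" if \<psi>: "\<psi> \<in> H_phys U" for \<psi>
  proof -
    have "norm (frame_obs U p g f \<psi> $ q) \<le> norm (\<psi> $ q) * K" for q
      using K(2)[of "U (g - p q) (\<psi> $ q)"] by (simp add: frame_obs_nth[OF \<psi>] norm_U)
    then have "norm (frame_obs U p g f \<psi>) \<le> L2_set (\<lambda>q. norm (\<psi> $ q) * K) UNIV"
      unfolding norm_vec_def by (intro L2_set_mono) auto
    also have "\<dots> = norm \<psi> * K"
      using K(1) by (simp add: norm_vec_def L2_set_left_distrib)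
    finally show ?thesis .
  qed
  moreover have "frame_obs U p g f \<in> H_phys U \<rightarrow>\<^sub>E H_phys U"
    using frame_obs_closed[OF p] by (auto simp: PiE_iff frame_obs_def)
  ultimately show ?thesis
    by (auto simp: bounded_ops_def vec_eq_iff frame_obs_nth H_phys_add H_phys_scaleC U_add U_scaleC f_simps)
qed

section \<open>Algebra operations and adjoints of fibrewise observables\<close>

lemma frame_obs_id: "(\<lambda>\<psi>\<in>H_phys U. \<psi>) = frame_obs U p g (\<lambda>v. v)"
  by (rule frame_obs_eqI) (simp_all add: U_U)

lemma frame_obs_add:
  "(\<lambda>\<psi>\<in>H_phys U. frame_obs U p g f \<psi> + frame_obs U p g h \<psi>) = frame_obs U p g (\<lambda>v. f v + h v)"
  by (rule frame_obs_eqI) (simp_all add: frame_obs_nth U_add)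

lemma frame_obs_scaleC:
  "(\<lambda>\<psi>\<in>H_phys U. c *\<^sub>C frame_obs U p g f \<psi>) = frame_obs U p g (\<lambda>v. c *\<^sub>C f v)"
  by (rule frame_obs_eqI) (simp_all add: frame_obs_nth U_scaleC)

lemma frame_obs_compose:
  assumes "covariant p"
  shows "compose (H_phys U) (frame_obs U p g f) (frame_obs U p g h) = frame_obs U p g (\<lambda>v. f (h v))"
  by (rule frame_obs_eqI)
    (simp_all add: compose_def frame_obs_closed[OF assms] frame_obs_nth U_U)

lemma adjoint_on_frame_obsI:
  assumes "adjoint_on UNIV f h"
  shows "adjoint_on (H_phys U) (frame_obs U p g f) (frame_obs U p g h)"
  using assms by (auto simp: adjoint_on_def cinner_vec_def frame_obs_nth cinner_U_left intro!: sum.cong)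

text \<open>Testing on orbit vectors through a point where the frame reads \<open>g\<close> strips
  the conjugation. \<open>T\<close> is not assumed to be an observable, so this supplies the
  candidate for closure under adjoints.\<close>

lemma adjoint_on_frame_obsD:
  assumes p: "covariant p" and q: "p q = g"
    and adj: "adjoint_on (H_phys U) (frame_obs U p g f) T" and T: "T \<in> H_phys U \<rightarrow> H_phys U"
  shows "adjoint_on UNIV f (\<lambda>w. T (orbit_vec U q w) $ q)"
proof -
  have "cinner (f v) w = cinner v (T (orbit_vec U q w) $ q)" for v w
  proof -
    let ?n = "of_nat (card (diag_orbit q)) :: complex"
    let ?F = "frame_obs U p g f (orbit_vec U q v)"
    \<comment> \<open>\<open>cinner_orbit_vec\<close> expects the orbit vector on the left, hence
      the swap.\<close>
    have "cinner ?F (orbit_vec U q w) = cnj (cinner (orbit_vec U q w) ?F)"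
      by (rule cinner_commute)
    also have "\<dots> = ?n * cinner (f v) w"
      by (simp add: cinner_orbit_vec[OF frame_obs_closed[OF p orbit_vec_H_phys]]
          frame_obs_orbit_vec q cinner_commute[of "f v" w])
    finally have "?n * cinner (f v) w = cinner ?F (orbit_vec U q w)" ..
    also have "\<dots> = cinner (orbit_vec U q v) (T (orbit_vec U q w))"
      using adj orbit_vec_H_phys by (simp add: adjoint_on_def)
    also have "\<dots> = ?n * cinner v (T (orbit_vec U q w) $ q)"
      using T orbit_vec_H_phys by (intro cinner_orbit_vec) blast
    finally show ?thesis
      using card_diag_orbit[of q] by simp
  qed
  then show ?thesis by (simp add: adjoint_on_def)
qed

lemma adjoint_on_H_phys_unique:
  assumes adj: "adjoint_on (H_phys U) S T" "adjoint_on (H_phys U) S T'"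
    and T: "T \<in> H_phys U \<rightarrow>\<^sub>E H_phys U" "T' \<in> H_phys U \<rightarrow>\<^sub>E H_phys U"
  shows "T = T'"
proof (rule PiE_ext[OF T])
  fix \<psi> assume \<psi>: "\<psi> \<in> H_phys U"
  have H: "T \<psi> \<in> H_phys U" "T' \<psi> \<in> H_phys U"
    using T \<psi> by blast+
  have "T \<psi> $ q = T' \<psi> $ q" for q
  proof (rule cinner_ext)
    fix v
    have "cinner (orbit_vec U q v) (T \<psi>) = cinner (orbit_vec U q v) (T' \<psi>)"
      using adj \<psi> orbit_vec_H_phys unfolding adjoint_on_def by metis
    then show "cinner v (T \<psi> $ q) = cinner v (T' \<psi> $ q)"
      using card_diag_orbit[of q] by (simp add: cinner_orbit_vec H)
  qed
  then show "T \<psi> = T' \<psi>" by (simp add: vec_eq_iff)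
qed

text \<open>Reading one fibre does not increase the norm, and \<open>orbit_vec\<close> rescales it
  by a constant.\<close>

lemma fibre_op_bounded:
  assumes T: "T \<in> bounded_ops (H_phys U)"
  shows "(\<lambda>w. T (orbit_vec U q w) $ q) \<in> bounded_ops UNIV"
proof -
  obtain K where K: "\<And>\<psi>. \<psi> \<in> H_phys U \<Longrightarrow> norm (T \<psi>) \<le> norm \<psi> * K"
    using T unfolding bounded_ops_def by blast
  have "norm (T (orbit_vec U q w) $ q) \<le> norm w * (sqrt (card (diag_orbit q)) * K)" for w
    using order_trans[OF Finite_Cartesian_Product.norm_nth_le K[OF orbit_vec_H_phys]] by (simp add: norm_orbit_vec mult_ac)
  then show ?thesis
    using T orbit_vec_H_phys
    by (intro bounded_opsI) (auto simp: bounded_ops_def orbit_vec_add orbit_vec_scaleC)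
qed

lemma frame_alg_star_subalgebra:
  assumes p: "covariant p"
  shows "star_subalgebra_on (H_phys U) (frame_obs U p g ` bounded_ops UNIV)"
proof -
  have adj: "T \<in> frame_obs U p g ` bounded_ops UNIV"
    if f: "f \<in> bounded_ops UNIV" and T: "T \<in> bounded_ops (H_phys U)"
      and adj: "adjoint_on (H_phys U) (frame_obs U p g f) T" for f T
  proof -
    obtain q where q: "p q = g" using covariant_surj[OF p] .
    define h where "h w = T (orbit_vec U q w) $ q" for w
    have T': "T \<in> H_phys U \<rightarrow>\<^sub>E H_phys U"
      using T by (auto simp: bounded_ops_def)
    have h: "h \<in> bounded_ops UNIV"
      unfolding h_def using fibre_op_bounded[OF T] .
    have "adjoint_on UNIV f h"
      unfolding h_def using T' by (intro adjoint_on_frame_obsD[OF p q adj]) auto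
    \<comment> \<open>Both sides are adjoints of the same observable, and adjoints on
      \<open>H_phys U\<close> are unique.\<close>
    then have "T = frame_obs U p g h"
      using frame_obs_bounded[OF p h]
      by (intro adjoint_on_H_phys_unique[OF adj adjoint_on_frame_obsI T']) (auto simp: bounded_ops_def)
    then show ?thesis using h by blast
  qed
  show ?thesis
    unfolding star_subalgebra_on_def ball_simps frame_obs_add frame_obs_scaleC
      frame_obs_compose[OF p] frame_obs_id[of p g]
    by (intro conjI ballI allI impI imageI subsetI)
      (auto simp: frame_obs_bounded[OF p] intro: adj bounded_ops_id bounded_ops_add bounded_ops_scaleC
        bounded_ops_compose)
qed

lemma frame_alg_isomorphic:
  assumes p: "covariant p" and p': "covariant p'"
  shows "star_isomorphic_on (H_phys U) (frame_obs U p g ` bounded_ops UNIV)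
    (frame_obs U p' g' ` bounded_ops UNIV)"
proof -
  let ?A = "frame_obs U p g" and ?B = "frame_obs U p' g'"
  \<comment> \<open>Both algebras are faithful copies of the bounded operators on \<open>'h\<close>;
    \<open>\<Phi>\<close> matches the observables of equal \<open>f\<close>.\<close>
  define \<Phi> where "\<Phi> = ?B \<circ> inv ?A"
  have inj: "inj ?A" "inj ?B"
    using frame_obs_inject[OF p] frame_obs_inject[OF p'] by (auto simp: inj_def)
  have \<Phi>: "\<Phi> (?A f) = ?B f" for f
    by (simp add: \<Phi>_def inv_f_f[OF inj(1)])
  have "bij_betw \<Phi> (?A ` bounded_ops UNIV) (?B ` bounded_ops UNIV)"
    using inj(2) by (auto simp: bij_betw_def inj_on_def \<Phi> image_image dest: injD)
  moreover have "adjoint_on (H_phys U) (?B f) (?B h)"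
    if h: "h \<in> bounded_ops UNIV" and adj: "adjoint_on (H_phys U) (?A f) (?A h)" for f h
  proof -
    obtain q where q: "p q = g" using covariant_surj[OF p] .
    have "?A h \<in> H_phys U \<rightarrow> H_phys U"
      using frame_obs_closed[OF p] by auto
    from adjoint_on_frame_obsD[OF p q adj this] have "adjoint_on UNIV f h"
      by (simp add: frame_obs_orbit_vec q)
    then show ?thesis by (rule adjoint_on_frame_obsI)
  qed
  moreover have "\<Phi> (\<lambda>\<psi>\<in>H_phys U. \<psi>) = (\<lambda>\<psi>\<in>H_phys U. \<psi>)"
    using \<Phi>[of "\<lambda>v. v"] by (simp only: frame_obs_id[symmetric])
  ultimately show ?thesis
    unfolding star_isomorphic_on_def
    by (intro exI[of _ \<Phi>])
      (auto simp: \<Phi> frame_obs_add frame_obs_scaleC frame_obs_compose[OF p] frame_obs_compose[OF p'])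
qed

section \<open>The overlap\<close>

lemma frame_obs_invariant:
  assumes "f \<in> invariant_ops U"
  shows "frame_obs U p g f = (\<lambda>\<psi>\<in>H_phys U. tensor_op id id f \<psi>)"
proof -
  have "U a (f (U (- a) v)) = f v" for a v
  proof -
    have "f (U (- a) v) = U (- a) (f v)"
      using assms by (simp add: invariant_ops_def fun_eq_iff)
    then show ?thesis by (simp add: U_U)
  qed
  \<comment> \<open>With \<open>a = p q - g\<close>, the inverse \<open>- a\<close> simplifies to
    the \<open>g - p q\<close> in \<open>frame_obs\<close>.\<close>
  from this[of "p _ - g"] show ?thesis
    by (intro frame_obs_eqI[symmetric]) (simp_all add: tensor_op_id_nth)
qed

text \<open>Over \<open>(i, j)\<close> one side is a conjugate of \<open>f\<close> depending on
  \<open>i\<close> only, the other a conjugate of \<open>h\<close> depending on \<open>j\<close>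
  only. As \<open>i\<close> and \<open>j\<close> vary independently, both are constant.\<close>

lemma frame_obs_fst_eq_snd:
  assumes "f \<in> bounded_ops UNIV" and eq: "frame_obs U fst g\<^sub>1 f = frame_obs U snd g\<^sub>2 h"
  shows "f \<in> invariant_ops U"
proof -
  have conj: "U (i - g\<^sub>1) (f (U (g\<^sub>1 - i) v)) = U (j - g\<^sub>2) (h (U (g\<^sub>2 - j) v))" for i j v
    using frame_obs_orbit_vec[of fst g\<^sub>1 f "(i, j)" v] frame_obs_orbit_vec[of snd g\<^sub>2 h "(i, j)" v] eq
    by simp
  \<comment> \<open>At \<open>(g\<^sub>1, g\<^sub>2)\<close> neither side is conjugated; moving only
    the second reading by \<open>k\<close> then conjugates \<open>h\<close>, which is
    \<open>f\<close>.\<close>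
  have "f v = h v" for v
    using conj[of g\<^sub>1 v g\<^sub>2] by simp
  then have "f v = U k (f (U (- k) v))" for k v
    using conj[of g\<^sub>1 v "g\<^sub>2 + k"] by simp
  then have "f (U k v) = U k (f v)" for k v
    by (metis U_U U_0 add.left_inverse)
  then show ?thesis
    using assms(1) by (auto simp: invariant_ops_def fun_eq_iff)
qed

lemma overlap_eq:
  "rel_alg1 U g\<^sub>1 \<inter> rel_alg2 U g\<^sub>2 = (\<lambda>f. \<lambda>\<psi>\<in>H_phys U. tensor_op id id f \<psi>) ` invariant_ops U"
proof (intro equalityI subsetI)
  fix T assume "T \<in> rel_alg1 U g\<^sub>1 \<inter> rel_alg2 U g\<^sub>2"
  then obtain f h where f: "f \<in> bounded_ops UNIV" "T = frame_obs U fst g\<^sub>1 f"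
    and h: "T = frame_obs U snd g\<^sub>2 h"
    by (auto simp: rel_alg1_def rel_alg2_def rel_obs1_eq rel_obs2_eq)
  have "f \<in> invariant_ops U"
    using frame_obs_fst_eq_snd f h by metis
  then show "T \<in> (\<lambda>f. \<lambda>\<psi>\<in>H_phys U. tensor_op id id f \<psi>) ` invariant_ops U"
    using f(2) frame_obs_invariant by auto
next
  fix T assume "T \<in> (\<lambda>f. \<lambda>\<psi>\<in>H_phys U. tensor_op id id f \<psi>) ` invariant_ops U"
  then obtain f where f: "f \<in> invariant_ops U" "T = (\<lambda>\<psi>\<in>H_phys U. tensor_op id id f \<psi>)" by auto
  then have "T = rel_obs1 U g\<^sub>1 f" "T = rel_obs2 U g\<^sub>2 f"
    by (simp_all add: rel_obs1_eq rel_obs2_eq frame_obs_invariant)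
  moreover have "f \<in> bounded_ops UNIV"
    using f(1) by (simp add: invariant_ops_def)
  ultimately show "T \<in> rel_alg1 U g\<^sub>1 \<inter> rel_alg2 U g\<^sub>2"
    unfolding rel_alg1_def rel_alg2_def by blast
qed

section \<open>Distinctness and non-triviality\<close>

lemma all_invariant_imp_scalar:
  assumes "bounded_ops UNIV \<subseteq> invariant_ops U"
  shows "\<exists>c. U g = (\<lambda>v. c *\<^sub>C v)"
proof (rule commuting_rank_ones_imp_scalar[OF U_bounded])
  show "rank_one x y \<circ> U g = U g \<circ> rank_one x y" for x y
    using assms rank_one_bounded by (auto simp: invariant_ops_def)
qed

text \<open>Equality of the algebras would make every bounded operator invariant, so
  \<open>U g\<close> would commute with all rank-one operators and be a scalar.\<close>

lemma rel_algs_distinct: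
  assumes "\<And>c. U g \<noteq> (\<lambda>v. c *\<^sub>C v)"
  shows "rel_alg1 U g\<^sub>1 \<noteq> rel_alg2 U g\<^sub>2"
proof
  assume eq: "rel_alg1 U g\<^sub>1 = rel_alg2 U g\<^sub>2"
  have "f \<in> invariant_ops U" if f: "f \<in> bounded_ops UNIV" for f
  proof -
    have "frame_obs U fst g\<^sub>1 f \<in> rel_alg2 U g\<^sub>2"
      using f unfolding eq[symmetric] by (auto simp: rel_alg1_def rel_obs1_eq)
    then obtain h where "frame_obs U fst g\<^sub>1 f = frame_obs U snd g\<^sub>2 h"
      by (auto simp: rel_alg2_def rel_obs2_eq)
    then show ?thesis using frame_obs_fst_eq_snd[OF f] by blast
  qed
  then show False
    using all_invariant_imp_scalar assms by blast
qed

lemma scalar_invariant: "(\<lambda>v. c *\<^sub>C v) \<in> invariant_ops U"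
  using bounded_ops_scaleC[OF bounded_ops_id] by (auto simp: invariant_ops_def U_scaleC fun_eq_iff)

text \<open>If \<open>U\<close> acts by scalars, every operator is invariant; otherwise some \<open>U g\<close> is itself an
  invariant operator that is not a scalar, because the group is abelian.\<close>

lemma nonscalar_invariant_exists:
  fixes x y :: 'h
  assumes "x \<noteq> 0" "\<And>c. y \<noteq> c *\<^sub>C x"
  obtains f where "f \<in> invariant_ops U" "\<And>c. f \<noteq> (\<lambda>v. c *\<^sub>C v)"
proof (cases "\<forall>g. \<exists>c. U g = (\<lambda>v. c *\<^sub>C v)")
  case True
  have "rank_one x x \<circ> U g = U g \<circ> rank_one x x" for g
  proof -
    obtain c where "U g = (\<lambda>v. c *\<^sub>C v)" using True by blast
    then show ?thesis
      by (auto simp: rank_one_def cinner_scaleC_right scaleC_scaleC)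
  qed
  then have "rank_one x x \<in> invariant_ops U"
    using rank_one_bounded by (auto simp: invariant_ops_def)
  then show ?thesis
    using that rank_one_not_scalar[OF assms] by blast
next
  case False
  then obtain g where g: "\<And>c. U g \<noteq> (\<lambda>v. c *\<^sub>C v)" by blast
  have "U g \<in> invariant_ops U"
    using U_bounded by (auto simp: invariant_ops_def U_U add.commute)
  then show ?thesis using that g by blast
qed

lemma overlap_nontrivial:
  fixes x y :: 'h
  assumes "x \<noteq> 0" "\<And>c. y \<noteq> c *\<^sub>C x"
  shows "scalar_ops (H_phys U) \<subset> rel_alg1 U g\<^sub>1 \<inter> rel_alg2 U g\<^sub>2"
proof
  have "(\<lambda>\<psi>\<in>H_phys U. c *\<^sub>C \<psi>) = (\<lambda>\<psi>\<in>H_phys U. tensor_op id id (\<lambda>v. c *\<^sub>C v) \<psi>)" for c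
    by (auto simp: vec_eq_iff tensor_op_id_nth)
  then show "scalar_ops (H_phys U) \<subseteq> rel_alg1 U g\<^sub>1 \<inter> rel_alg2 U g\<^sub>2"
    unfolding overlap_eq scalar_ops_def using scalar_invariant by blast
  obtain f where f: "f \<in> invariant_ops U" "\<And>c. f \<noteq> (\<lambda>v. c *\<^sub>C v)"
    using nonscalar_invariant_exists[OF assms] by blast
  define T where "T = (\<lambda>\<psi>\<in>H_phys U. tensor_op id id f \<psi>)"
  \<comment> \<open>The fibre over \<open>0\<close> gives \<open>f\<close> back, so a scalar
    \<open>T\<close> would force \<open>f\<close> to be a scalar.\<close>
  have T: "T (orbit_vec U 0 v) $ 0 = f v" for v
    by (simp add: T_def tensor_op_id_nth orbit_vec_H_phys)
  have "T \<noteq> (\<lambda>\<psi>\<in>H_phys U. c *\<^sub>C \<psi>)" for c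
  proof
    assume "T = (\<lambda>\<psi>\<in>H_phys U. c *\<^sub>C \<psi>)"
    then have "f v = c *\<^sub>C v" for v
      using T[of v] by (simp add: orbit_vec_H_phys)
    then show False using f(2) by blast
  qed
  then have "T \<notin> scalar_ops (H_phys U)"
    by (auto simp: scalar_ops_def)
  moreover have "T \<in> rel_alg1 U g\<^sub>1 \<inter> rel_alg2 U g\<^sub>2"
    unfolding overlap_eq T_def using f(1) by blast
  ultimately show "scalar_ops (H_phys U) \<noteq> rel_alg1 U g\<^sub>1 \<inter> rel_alg2 U g\<^sub>2"
    by blast
qed

section \<open>Reorientations of the frames\<close>

lemma reorient1_H_phys: "\<psi> \<in> H_phys U \<Longrightarrow> tensor_op (regular g) id id \<psi> \<in> H_phys U"
  by (simp add: H_phys_iff reorient1_nth add_diff_eq[symmetric] del: add_Pair)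

lemma reorient2_H_phys: "\<psi> \<in> H_phys U \<Longrightarrow> tensor_op id (regular g) id \<psi> \<in> H_phys U"
  by (simp add: H_phys_iff reorient2_nth add_diff_eq[symmetric] del: add_Pair)

text \<open>Overlap operators apply one and the same \<open>f\<close> in every fibre, while
  reorientations only permute the fibres.\<close>

lemma overlap_commutes_reorientations:
  assumes "T \<in> rel_alg1 U g\<^sub>1 \<inter> rel_alg2 U g\<^sub>2" "\<psi> \<in> H_phys U"
  shows "T (tensor_op (regular g) id id \<psi>) = tensor_op (regular g) id id (T \<psi>)"
    and "T (tensor_op id (regular g) id \<psi>) = tensor_op id (regular g) id (T \<psi>)"
  using assms unfolding overlap_eq
  by (auto simp: vec_eq_iff reorient1_H_phys reorient2_H_phys reorient1_nth reorient2_nth tensor_op_id_nth)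

end

text \<open>The two conditional clauses exclude degenerate cases. If every \<open>U g\<close> is a
  scalar, all \<open>f\<close> are invariant and the algebras coincide; if \<open>'h\<close> has
  dimension at most one, all its operators are scalars and so is the overlap.\<close>

theorem theorem1:
  fixes U :: "'g::{finite, ab_group_add} \<Rightarrow> 'h::complex_hilbert \<Rightarrow> 'h"
    and g\<^sub>1 g\<^sub>2 :: 'g
  assumes "CARD('g) > 1"
    and "unitary_rep U"
  shows "star_subalgebra_on (H_phys U) (rel_alg1 U g\<^sub>1) \<and>
    star_subalgebra_on (H_phys U) (rel_alg2 U g\<^sub>2) \<and>
    star_isomorphic_on (H_phys U) (rel_alg1 U g\<^sub>1) (rel_alg2 U g\<^sub>2) \<and>
    ((\<exists>g. \<forall>c. U g \<noteq> (\<lambda>v. c *\<^sub>C v)) \<longrightarrow> rel_alg1 U g\<^sub>1 \<noteq> rel_alg2 U g\<^sub>2) \<and>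
    ((\<exists>x y :: 'h. x \<noteq> 0 \<and> (\<forall>c. y \<noteq> c *\<^sub>C x)) \<longrightarrow>
      scalar_ops (H_phys U) \<subset> rel_alg1 U g\<^sub>1 \<inter> rel_alg2 U g\<^sub>2) \<and>
    rel_alg1 U g\<^sub>1 \<inter> rel_alg2 U g\<^sub>2 =
      {(\<lambda>\<psi>\<in>H_phys U. tensor_op id id f (Pi_phys U \<psi>)) |f. f \<in> invariant_ops U} \<and>
    (\<forall>f \<in> invariant_ops U. (\<lambda>\<psi>\<in>H_phys U. tensor_op id id f (Pi_phys U \<psi>)) =
      (\<lambda>\<psi>\<in>H_phys U. tensor_op id id f \<psi>)) \<and>
    (\<forall>T \<in> rel_alg1 U g\<^sub>1 \<inter> rel_alg2 U g\<^sub>2. \<forall>g. \<forall>\<psi>\<in>H_phys U.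
      T (tensor_op (regular g) id id \<psi>) = tensor_op (regular g) id id (T \<psi>) \<and>
      T (tensor_op id (regular g) id \<psi>) = tensor_op id (regular g) id (T \<psi>))"
proof (intro conjI impI ballI allI)
  note rep = assms(2)
  show "star_subalgebra_on (H_phys U) (rel_alg1 U g\<^sub>1)"
    using frame_alg_star_subalgebra[OF rep covariant_fst]
    by (simp add: rel_alg1_def rel_obs1_eq[OF rep] cong: image_cong)
  show "star_subalgebra_on (H_phys U) (rel_alg2 U g\<^sub>2)"
    using frame_alg_star_subalgebra[OF rep covariant_snd]
    by (simp add: rel_alg2_def rel_obs2_eq[OF rep] cong: image_cong)
  show "star_isomorphic_on (H_phys U) (rel_alg1 U g\<^sub>1) (rel_alg2 U g\<^sub>2)"
    using frame_alg_isomorphic[OF rep covariant_fst covariant_snd]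
    by (simp add: rel_alg1_def rel_alg2_def rel_obs1_eq[OF rep] rel_obs2_eq[OF rep] cong: image_cong)
  show "rel_alg1 U g\<^sub>1 \<noteq> rel_alg2 U g\<^sub>2" if "\<exists>g. \<forall>c. U g \<noteq> (\<lambda>v. c *\<^sub>C v)"
    using that rel_algs_distinct[OF rep] by blast
  show "scalar_ops (H_phys U) \<subset> rel_alg1 U g\<^sub>1 \<inter> rel_alg2 U g\<^sub>2"
    if "\<exists>x y :: 'h. x \<noteq> 0 \<and> (\<forall>c. y \<noteq> c *\<^sub>C x)"
    using that overlap_nontrivial[OF rep] by blast
  have restr: "(\<lambda>\<psi>\<in>H_phys U. tensor_op id id f (Pi_phys U \<psi>)) =
      (\<lambda>\<psi>\<in>H_phys U. tensor_op id id f \<psi>)" for f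
    by (intro restrict_ext) (simp add: Pi_phys_H_phys[OF rep])
  then show "(\<lambda>\<psi>\<in>H_phys U. tensor_op id id f (Pi_phys U \<psi>)) =
      (\<lambda>\<psi>\<in>H_phys U. tensor_op id id f \<psi>)" for f .
  show "rel_alg1 U g\<^sub>1 \<inter> rel_alg2 U g\<^sub>2 =
      {(\<lambda>\<psi>\<in>H_phys U. tensor_op id id f (Pi_phys U \<psi>)) |f. f \<in> invariant_ops U}"
    unfolding restr overlap_eq[OF rep] by blast
  show "T (tensor_op (regular g) id id \<psi>) = tensor_op (regular g) id id (T \<psi>)"
    "T (tensor_op id (regular g) id \<psi>) = tensor_op id (regular g) id (T \<psi>)"
    if "T \<in> rel_alg1 U g\<^sub>1 \<inter> rel_alg2 U g\<^sub>2" "\<psi> \<in> H_phys U" for T g \<psi>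
    using that overlap_commutes_reorientations[OF rep] by blast+
qed

end
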